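(* Let $v:[0,\infty)\times\mathbb{R}\to[0,\infty)$ be an arbitrage-free total implied volatility surface which is $C^{1,2}$ on $(0,\infty)\times\mathbb{R}$ with $v(T,k)>0$ for all $T>0$, $k\in\mathbb{R}$, and let $\sigma_{\mathrm{BS}}(T,k)=\frac1{\sqrt T}v(T,k)$ be the corresponding implied volatility. Let $h:(0,\infty)\times\mathbb{R}\to(0,\infty)$ be the unique strictly positive function, continuous in its second variable, such that $$v(T,k)=\frac{1}{\frac1k\int_0^k\frac1{h(T,y)}\,dy}\qquad\text{for all }k\neq0,\ T>0.$$ Let $\sigma_{\mathrm{Dup}}$ be the Dupire local volatility associated with $v$ (as defined in the context). Then, for every $(T,k)\in(0,\infty)\times\mathbb{R}$ such that $\partial_Tv(T,k)>0$, $$\Sigma(T,k):=\frac1{\sqrt T}\,h(T,k)=\frac{\sigma_{\mathrm{Dup}}(T,k)}{\sqrt{1+T\,a(T,k)+T^2\,b(T,k)}},$$ where $$a(T,k)=\biggl(\frac{2\,\partial_T\sigma_{\mathrm{BS}}}{\sigma_{\mathrm{BS}}}-\frac{\partial_{kk}\sigma_{\mathrm{BS}}}{\sigma_{\mathrm{BS}}}\,\sigma_{\mathrm{Dup}}^2\biggr)(T,k),\qquad b(T,k)=\frac14\bigl(\partial_k\sigma_{\mathrm{BS}}(T,k)\bigr)^2\sigma_{\mathrm{Dup}}(T,k)^2.$$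
   Context: Let $N$ be the standard Gaussian cumulative distribution function. The normalized Black-Scholes call price $c_{\mathrm{BS}}:\mathbb{R}\times[0,\infty)\to[0,\infty)$ is $$c_{\mathrm{BS}}(k,v)=N(d_1(k,v))-e^kN(d_0(k,v))\ \text{ if } v>0,\qquad c_{\mathrm{BS}}(k,0)=(1-e^k)^+,$$ where $d_0(k,v)=-\frac kv-\frac v2$ and $d_1(k,v)=-\frac kv+\frac v2$ for $v>0$. A function $u:\mathbb{R}\to[0,\infty)$ is an arbitrage-free total implied volatility if $K\in(0,\infty)\mapsto c_{\mathrm{BS}}\bigl(\log\frac KF,u(\log\frac KF)\bigr)$ is convex and tends to $0$ as $K\to\infty$, for some (equivalently, any) $F>0$. A total implied volatility surface $v(T,k)$ ($T$ = time to maturity, $k$ = forward log-moneyness) is taken here to be such that $v(0,\cdot)\equiv0$ and, for every $T>0$, the slice $v(T,\cdot)$ is an arbitrage-free total implied volatility. When each slice is moreover $C^1$ and strictly positive, the function $h$ of the claim is known to exist and to be unique. The Dupire local volatility $\sigma_{\mathrm{Dup}}(T,k)\ge0$ is defined, for $T>0$, $k\in\mathbb{R}$, by $$\sigma_{\mathrm{Dup}}(T,k)^2=\frac{2\,\partial_Tv(T,k)}{\Bigl(v''-\frac v4(v')^2+\frac1v\bigl(1-\frac{k\,v'}{v}\bigr)^2\Bigr)(T,k)},$$ where $v'=\partial_kv$, $v''=\partial_{kk}v$; it is a standing assumption that the denominator (which is non-negative by absence of arbitrage) is strictly positive at the points considered, so that $\sigma_{\mathrm{Dup}}$ is well defined there.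 $C^{1,2}$ means continuously differentiable once in $T$ and twice in $k$. *)

theory Defs
  imports "HOL-Probability.Probability"
begin

definition std_normal_cdf :: "real \<Rightarrow> real" where
  "std_normal_cdf = cdf std_normal_distribution"

definition d0 :: "real \<Rightarrow> real \<Rightarrow> real" where
  "d0 k v = - k / v - v / 2"

definition d1 :: "real \<Rightarrow> real \<Rightarrow> real" where
  "d1 k v = - k / v + v / 2"

(* Only the arguments v >= 0 are meaningful; the second branch is the case v = 0. *)
definition c_BS :: "real \<Rightarrow> real \<Rightarrow> real" where
  "c_BS k v = (if v > 0 then std_normal_cdf (d1 k v) - exp k * std_normal_cdf (d0 k v)
               else max 0 (1 - exp k))"

definition arbitrage_free_tiv :: "(real \<Rightarrow> real) \<Rightarrow> bool" where
  "arbitrage_free_tiv u \<longleftrightarrow>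
     (\<forall>k. 0 \<le> u k) \<and>
     (\<exists>F>0. convex_on {0<..} (\<lambda>K. c_BS (ln (K / F)) (u (ln (K / F)))) \<and>
            ((\<lambda>K. c_BS (ln (K / F)) (u (ln (K / F)))) \<longlongrightarrow> 0) at_top)"

(* A function v on [0,\<infinity>) \<times> \<real> is a curried total function of maturity and log-moneyness;
   its values at negative maturities are irrelevant. *)
definition arbitrage_free_surface :: "(real \<Rightarrow> real \<Rightarrow> real) \<Rightarrow> bool" where
  "arbitrage_free_surface v \<longleftrightarrow>
     (\<forall>k. v 0 k = 0) \<and> (\<forall>T>0. arbitrage_free_tiv (v T))"

definition dT :: "(real \<Rightarrow> real \<Rightarrow> real) \<Rightarrow> real \<Rightarrow> real \<Rightarrow> real" where
  "dT f T k = deriv (\<lambda>t. f t k) T"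

definition dk :: "(real \<Rightarrow> real \<Rightarrow> real) \<Rightarrow> real \<Rightarrow> real \<Rightarrow> real" where
  "dk f T k = deriv (\<lambda>y. f T y) k"

abbreviation dkk :: "(real \<Rightarrow> real \<Rightarrow> real) \<Rightarrow> real \<Rightarrow> real \<Rightarrow> real" where
  "dkk f \<equiv> dk (dk f)"

(* deriv is unspecified where the derivative does not exist, so existence of the partial
   derivatives is required separately from their joint continuity. *)
definition C12 :: "(real \<Rightarrow> real \<Rightarrow> real) \<Rightarrow> bool" where
  "C12 f \<longleftrightarrow>
     (\<forall>T>0. \<forall>k. (\<lambda>t. f t k) differentiable at T \<and>
               (\<lambda>y. f T y) differentiable at k \<and>
               (\<lambda>y. dk f T y) differentiable at k) \<and>
     continuous_on ({0<..} \<times> UNIV) (\<lambda>(T, k). f T k) \<and>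
     continuous_on ({0<..} \<times> UNIV) (\<lambda>(T, k). dT f T k) \<and>
     continuous_on ({0<..} \<times> UNIV) (\<lambda>(T, k). dk f T k) \<and>
     continuous_on ({0<..} \<times> UNIV) (\<lambda>(T, k). dkk f T k)"

definition sigma_BS :: "(real \<Rightarrow> real \<Rightarrow> real) \<Rightarrow> real \<Rightarrow> real \<Rightarrow> real" where
  "sigma_BS v T k = 1 / sqrt T * v T k"

definition dupire_denom :: "(real \<Rightarrow> real \<Rightarrow> real) \<Rightarrow> real \<Rightarrow> real \<Rightarrow> real" where
  "dupire_denom v T k =
     dkk v T k - v T k / 4 * (dk v T k)\<^sup>2 + 1 / v T k * (1 - k * dk v T k / v T k)\<^sup>2"

(* The local volatility is the non-negative root of the Dupire quotient; meaningful where
   dT v T k \<ge> 0 and dupire_denom v T k > 0. *)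
definition sigma_Dup :: "(real \<Rightarrow> real \<Rightarrow> real) \<Rightarrow> real \<Rightarrow> real \<Rightarrow> real" where
  "sigma_Dup v T k = sqrt (2 * dT v T k / dupire_denom v T k)"

definition coeff_a :: "(real \<Rightarrow> real \<Rightarrow> real) \<Rightarrow> real \<Rightarrow> real \<Rightarrow> real" where
  "coeff_a v T k =
     2 * dT (sigma_BS v) T k / sigma_BS v T k
     - dkk (sigma_BS v) T k / sigma_BS v T k * (sigma_Dup v T k)\<^sup>2"

definition coeff_b :: "(real \<Rightarrow> real \<Rightarrow> real) \<Rightarrow> real \<Rightarrow> real \<Rightarrow> real" where
  "coeff_b v T k = 1 / 4 * (dk (sigma_BS v) T k)\<^sup>2 * (sigma_Dup v T k)\<^sup>2"

end

theory Submission imports Defs begin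

text \<open>
  The representation of \<open>v\<close> says \<open>k / v = \<integral>\<^sub>0\<^sup>k 1 / h\<close>; differentiating in \<open>k\<close> gives
  \<open>h = v / q\<close> with \<open>q = 1 - k v' / v\<close>, so that \<open>q > 0\<close>. Since
  \<open>\<sigma>\<^sub>B\<^sub>S = v / \<surd>T\<close>, the Dupire equation \<open>2 \<partial>\<^sub>T v = \<sigma>\<^sup>2 (v'' - v v'\<^sup>2 / 4 + q\<^sup>2 / v)\<close> makes
  all terms of \<open>1 + T a + T\<^sup>2 b\<close> cancel except \<open>T \<sigma>\<^sup>2 q\<^sup>2 / v\<^sup>2\<close>.
\<close>

lemma interval_integral_has_real_derivative:
  fixes f :: "real \<Rightarrow> real"
  assumes "continuous_on UNIV f"
  shows "((\<lambda>u. LBINT y=ereal c..ereal u. f y) has_real_derivative f x) (at x)"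
proof -
  \<comment> \<open>\<open>interval_integral_FTC2\<close> works within a compact interval. This one
    contains \<open>c\<close> and, thanks to the margin 1, has \<open>x\<close> in its interior, so
    the derivative within it is the full one.\<close>
  define a b where "a = min c x - 1" and "b = max c x + 1"
  have "((\<lambda>u. LBINT y=ereal c..ereal u. f y) has_vector_derivative f x) (at x within {a..b})"
    by (rule interval_integral_FTC2)
       (auto simp: a_def b_def intro: continuous_on_subset[OF assms])
  moreover have "at x within {a..b} = at x"
    by (rule at_within_interior) (auto simp: a_def b_def)
  ultimately show ?thesis
    by (simp add: has_real_derivative_iff_has_vector_derivative)
qed

text \<open>Rewriting \<open>repr\<close> as an identity between the integral of
  \<open>1 / g\<close> and \<open>y / w y\<close> lets both sides be differentiated: the fundamental
  theorem on the left, the quotient rule on the right.\<close>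

lemma harmonic_mean_inverse:
  fixes w g :: "real \<Rightarrow> real"
  assumes w_pos: "\<And>y. w y > 0"
    and w_diff: "w differentiable at k"
    and g_pos: "\<And>y. g y > 0"
    and g_cont: "continuous_on UNIV g"
    and repr: "\<And>y. y \<noteq> 0 \<Longrightarrow> w y = 1 / (1 / y * (LBINT z=0..y. 1 / g z))"
  shows "1 / g k = (1 - k * deriv w k / w k) / w k"
proof -
  have "continuous_on UNIV (\<lambda>y. 1 / g y)"
    using g_pos by (intro continuous_intros g_cont) (simp add: less_imp_neq[symmetric])
  from interval_integral_has_real_derivative[OF this, of 0 k]
  have "((\<lambda>y. LBINT z=0..y. 1 / g z) has_real_derivative 1 / g k) (at k)"
    by (simp add: zero_ereal_def)
  \<comment> \<open>At \<open>y = 0\<close> both sides vanish, so the derivative at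
    \<open>k = 0\<close> is covered too. For other \<open>y\<close>, a zero integral would give
    \<open>w y = 1 / 0 = 0\<close>, against \<open>w_pos\<close>.\<close>
  moreover have "(LBINT z=0..y. 1 / g z) = y / w y" for y
  proof (cases "y = 0")
    case True
    then show ?thesis by (simp add: zero_ereal_def[symmetric])
  next
    case False
    then show ?thesis using repr[OF False] w_pos[of y] by (auto simp: field_simps)
  qed
  ultimately have "((\<lambda>y. y / w y) has_real_derivative 1 / g k) (at k)"
    by simp
  moreover have "(w has_real_derivative deriv w k) (at k)"
    using w_diff by (simp add: DERIV_deriv_iff_real_differentiable)
  then have "((\<lambda>y. y / w y) has_real_derivative (w k - k * deriv w k) / (w k * w k)) (at k)"
    using w_pos[of k] by (auto intro!: derivative_eq_intros)
  ultimately have "1 / g k = (w k - k * deriv w k) / (w k * w k)"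
    by (rule DERIV_unique)
  then show ?thesis
    using w_pos[of k] by (simp add: field_simps)
qed

context
  fixes v :: "real \<Rightarrow> real \<Rightarrow> real" and T :: real
  assumes smooth: "C12 v" and T_pos: "T > 0"
begin

lemma dT_sigma_BS:
  "dT (sigma_BS v) T k = (dT v T k - v T k / (2 * T)) / sqrt T"
proof -
  have "((\<lambda>t. v t k) has_real_derivative dT v T k) (at T)"
    using smooth T_pos by (simp add: C12_def dT_def DERIV_deriv_iff_real_differentiable)
  then have "((\<lambda>t. sigma_BS v t k) has_real_derivative
      (dT v T k - v T k / (2 * T)) / sqrt T) (at T)"
    unfolding sigma_BS_def using T_pos
    by (auto intro!: derivative_eq_intros simp: field_simps real_sqrt_mult[symmetric])
  then show ?thesis
    unfolding dT_def by (rule DERIV_imp_deriv)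
qed

text \<open>The equation is between functions of \<open>k\<close>, so that it can be rewritten
  inside the outer derivative of \<open>dkk\<close>.\<close>

lemma dk_sigma_BS: "dk (sigma_BS v) T = (\<lambda>k. dk v T k / sqrt T)"
proof
  fix k
  have "(\<lambda>y. v T y) field_differentiable at k"
    using smooth T_pos
    by (simp add: C12_def real_differentiable_def field_differentiable_def)
  moreover have "sigma_BS v T = (\<lambda>y. v T y / sqrt T)"
    by (rule ext) (simp add: sigma_BS_def)
  ultimately show "dk (sigma_BS v) T k = dk v T k / sqrt T"
    by (simp only: dk_def deriv_cdivide_right)
qed

lemma dkk_sigma_BS: "dkk (sigma_BS v) T k = dkk v T k / sqrt T"
proof -
  have "(\<lambda>y. dk v T y) field_differentiable at k"
    using smooth T_pos
    by (simp add: C12_def real_differentiable_def field_differentiable_def)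
  then show ?thesis
    unfolding dk_def[of "dk (sigma_BS v)"] dk_def[of "dk v"] dk_sigma_BS
    by (rule deriv_cdivide_right)
qed

end

theorem proposition4p2:
  fixes v h :: "real \<Rightarrow> real \<Rightarrow> real"
  assumes surface: "arbitrage_free_surface v"
    and smooth: "C12 v"
    and v_pos: "\<And>T k. T > 0 \<Longrightarrow> v T k > 0"
    and h_pos: "\<And>T k. T > 0 \<Longrightarrow> h T k > 0"
    and h_cont: "\<And>T. T > 0 \<Longrightarrow> continuous_on UNIV (h T)"
    and h_repr: "\<And>T k. T > 0 \<Longrightarrow> k \<noteq> 0 \<Longrightarrow>
                   v T k = 1 / (1 / k * (LBINT y=0..k. 1 / h T y))"
  shows "\<forall>T>0. \<forall>k. dupire_denom v T k > 0 \<longrightarrow> dT v T k > 0 \<longrightarrow>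
           1 / sqrt T * h T k =
             sigma_Dup v T k / sqrt (1 + T * coeff_a v T k + T\<^sup>2 * coeff_b v T k)"
proof (intro allI impI)
  fix T k :: real
  assume T: "T > 0" and D: "dupire_denom v T k > 0" and dT: "dT v T k > 0"
  define q where "q = 1 - k * dk v T k / v T k"
  define s where "s = sigma_Dup v T k"
  note v = v_pos[OF T, of k] and h = h_pos[OF T, of k]
  have "1 / h T k = q / v T k"
    unfolding q_def dk_def
    by (rule harmonic_mean_inverse[OF v_pos[OF T] _ h_pos[OF T] h_cont[OF T] h_repr[OF T]])
       (use smooth T in \<open>simp_all add: C12_def\<close>)
  with v h have q: "q > 0" and h_eq: "h T k = v T k / q"
    by (auto simp: field_simps zero_less_mult_iff)
  have s: "s > 0"
    using D dT by (simp add: s_def sigma_Dup_def)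
  \<comment> \<open>Positivity of \<open>D\<close> and \<open>dT\<close> makes the radicand
    nonnegative, so squaring undoes the root.\<close>
  have s2: "s\<^sup>2 = 2 * dT v T k / dupire_denom v T k"
    using D dT by (simp add: s_def sigma_Dup_def)
  have dupire: "2 * dT v T k =
      s\<^sup>2 * (dkk v T k - v T k / 4 * (dk v T k)\<^sup>2 + q\<^sup>2 / v T k)"
    using s2 D by (simp add: dupire_denom_def q_def)
  \<comment> \<open>The summand 1 is absorbed by the term \<open>- v T k / (2 * T)\<close> that
    comes from differentiating \<open>1 / sqrt T\<close>. Keeping \<open>2 * dT v T k\<close> intact
    lets \<open>dupire\<close> rewrite it below.\<close>
  have a: "1 + T * coeff_a v T k = T / v T k * (2 * dT v T k - dkk v T k * s\<^sup>2)"
    using T v unfolding coeff_a_def s_def[symmetric]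
      dT_sigma_BS[OF smooth T] dkk_sigma_BS[OF smooth T] sigma_BS_def
    by (simp add: field_simps)
  have b: "T\<^sup>2 * coeff_b v T k = T / v T k * (v T k / 4 * (dk v T k)\<^sup>2 * s\<^sup>2)"
    using T v unfolding coeff_b_def s_def[symmetric] dk_sigma_BS[OF smooth T]
    by (simp add: field_simps power2_eq_square)
  have "1 + T * coeff_a v T k + T\<^sup>2 * coeff_b v T k = T * (s * q / v T k)\<^sup>2"
    unfolding a b dupire using v by (simp add: field_simps power2_eq_square)
  \<comment> \<open>No absolute value remains, since \<open>s\<close>, \<open>q\<close> and
    \<open>v T k\<close> are positive.\<close>
  then have root: "sqrt (1 + T * coeff_a v T k + T\<^sup>2 * coeff_b v T k) = sqrt T * (s * q / v T k)"
    using s q v by (simp add: real_sqrt_mult)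
  show "1 / sqrt T * h T k =
      sigma_Dup v T k / sqrt (1 + T * coeff_a v T k + T\<^sup>2 * coeff_b v T k)"
    using s q v T unfolding root h_eq s_def[symmetric] by (simp add: field_simps)
qed

end
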